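(* Let $n\geq 1$ and let $\alpha$ be a permutation of $[n]=\{1,\dots,n\}$. Then $$\max_{\gamma}\{|C(\alpha \gamma)-C(\gamma)|\}=n-C(\alpha),$$ where $\gamma$ ranges over all permutations of $[n]$.
   Context: $C(\pi)$ denotes the number of cycles in the disjoint cycle decomposition of a permutation $\pi$ (fixed points count as cycles). Products of permutations are compositions of maps. *)

theory Defs
  imports "HOL-Combinatorics.Orbits" "HOL-Combinatorics.Cycles"
begin

text \<open>
  A cycle of a permutation of \<open>S\<close> is represented by the set of points it moves around, i.e. by
  an orbit; a fixed point \<open>x\<close> contributes the orbit \<open>{x}\<close>.
\<close>

definition num_cycles :: "'a set \<Rightarrow> ('a \<Rightarrow> 'a) \<Rightarrow> nat" where
  "num_cycles S p = card (orbit p ` S)"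

lemma orbit_cycle_of_list:
  assumes "distinct cs" "x \<in> set cs"
  shows "orbit (cycle_of_list cs) x = set cs"
proof -
  have rot: "((cycle_of_list cs) ^^ m) (cs ! i) = cs ! ((m + i) mod length cs)"
    if "i < length cs" for m i
  proof -
    have "((cycle_of_list cs) ^^ m) (cs ! i) = map ((cycle_of_list cs) ^^ m) cs ! i"
      using that by simp
    also have "\<dots> = rotate m cs ! i"
      using cyclic_rotation[OF assms(1)] by simp
    finally show ?thesis using that by (simp add: nth_rotate)
  qed
  obtain i where i: "i < length cs" "x = cs ! i"
    using assms(2) by (auto simp: in_set_conv_nth)
  have "y \<in> orbit (cycle_of_list cs) x" if y: "y \<in> set cs" for y
  proof -
    obtain j where j: "j < length cs" "y = cs ! j"
      using y by (auto simp: in_set_conv_nth)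
    define m where "m = j + length cs - i"
    have "m > 0" "m + i = j + length cs" using i by (auto simp: m_def)
    then have "((cycle_of_list cs) ^^ m) x = y" using rot[OF i(1), of m] i j by simp
    then show ?thesis using \<open>m > 0\<close> by (auto simp: orbit_altdef)
  qed
  moreover have "y \<in> set cs" if "y \<in> orbit (cycle_of_list cs) x" for y
    using that rot[OF i(1)] i
    by (auto simp: orbit_altdef intro!: nth_mem mod_less_divisor)
  ultimately show ?thesis by blast
qed

lemma orbit_cong_on:
  assumes "x \<in> A" "\<And>y. y \<in> A \<Longrightarrow> f y = g y" "\<And>y. y \<in> A \<Longrightarrow> g y \<in> A"
  shows "orbit f x = orbit g x"
proof -
  have "(f ^^ k) x = (g ^^ k) x \<and> (g ^^ k) x \<in> A" for k
    by (induction k) (use assms in auto)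
  then show ?thesis by (simp add: orbit_altdef)
qed

text \<open>
  Every way of writing \<open>p\<close> as a product of disjoint cycles covering \<open>S\<close>, with singleton lists
  for fixed points, has exactly \<open>num_cycles S p\<close> factors.
\<close>

lemma num_cycles_eq_length:
  assumes "distinct (concat css)" "[] \<notin> set css"
  shows "num_cycles (set (concat css)) (foldr (\<lambda>cs p. cycle_of_list cs \<circ> p) css id) = length css"
  using assms
proof (induction css)
  case Nil
  then show ?case by (simp add: num_cycles_def)
next
  case (Cons cs css)
  define q where "q = foldr (\<lambda>cs p. cycle_of_list cs \<circ> p) css id"
  define p where "p = cycle_of_list cs \<circ> q"
  define I where "I = set (concat css)"
  have perm: "foldr (\<lambda>cs p. cycle_of_list cs \<circ> p) dss id permutes set (concat dss)" for dss :: "'a list list"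
  proof (induction dss)
    case Nil
    then show ?case using permutes_id[of "{}"] by (simp add: id_def)
  next
    case (Cons ds dss)
    have 1: "cycle_of_list ds permutes set (concat (ds # dss))"
      using cycle_permutes[of ds] by (rule permutes_subset) auto
    have 2: "foldr (\<lambda>cs p. cycle_of_list cs \<circ> p) dss id permutes set (concat (ds # dss))"
      using Cons by (rule permutes_subset) auto
    show ?case unfolding foldr.simps o_apply[of _ "foldr _ dss"] by (rule permutes_compose[OF 2 1])
  qed
  have q: "q permutes I" using perm[of css] by (simp add: q_def I_def)
  have disj: "set cs \<inter> I = {}" and cs: "distinct cs" "cs \<noteq> []"
    using Cons.prems by (auto simp: I_def)
  have "orbit p x = set cs" if "x \<in> set cs" for x
  proof -
    have "orbit p x = orbit (cycle_of_list cs) x"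
    proof (rule orbit_cong_on[OF that])
      show "p y = cycle_of_list cs y" if "y \<in> set cs" for y
      proof -
        have "y \<notin> I" using that disj by blast
        then show ?thesis using permutes_not_in[OF q] by (simp add: p_def)
      qed
      show "cycle_of_list cs y \<in> set cs" if "y \<in> set cs" for y
        using that permutes_in_image[OF cycle_permutes[of cs], of y] by simp
    qed
    then show ?thesis using orbit_cycle_of_list[OF cs(1) that] by simp
  qed
  then have A: "orbit p ` set cs = {set cs}" using cs(2) by (simp add: image_constant_conv)
  have "orbit p x = orbit q x" if "x \<in> I" for x
  proof (rule orbit_cong_on[OF that])
    show qI: "q y \<in> I" if "y \<in> I" for y
      using that permutes_in_image[OF q, of y] by simp
    show "p y = q y" if "y \<in> I" for y
    proof -
      have "q y \<notin> set cs" using qI[OF that] disj by blast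
      then show ?thesis unfolding p_def o_apply by (rule id_outside_supp)
    qed
  qed
  then have B: "orbit p ` I = orbit q ` I" by (simp cong: image_cong)
  have "orbit q x \<subseteq> I" if "x \<in> I" for x
    using permutes_orbit_subset[OF q that] .
  then have "set cs \<notin> orbit q ` I" using disj cs(2)
    by (metis Int_absorb2 image_iff set_empty)
  then have "card (orbit p ` (set cs \<union> I)) = Suc (card (orbit q ` I))"
    using A B by (simp add: image_Un I_def)
  also have "card (orbit q ` I) = length css"
  proof -
    have "distinct (concat css)" "[] \<notin> set css" using Cons.prems by auto
    then show ?thesis using Cons.IH unfolding num_cycles_def q_def I_def by blast
  qed
  finally show ?case
    by (simp add: num_cycles_def p_def q_def I_def comp_def id_def)
qed

end

(* The choice \<gamma> = id gives n - C(\<alpha>). For the upper bound, left multiplication by a transposition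
   (a b) only affects the cycles through a and b, so it changes the number of cycles by at most 1;
   and if \<alpha> moves a, then (a \<alpha>(a)) \<circ> \<alpha> splits off the fixed point a and has more cycles than \<alpha>.
   Hence \<alpha> is a product of at most n - C(\<alpha>) transpositions. *)
theory Submission
  imports Defs
begin

lemma num_cycles_le_card:
  assumes "finite S"
  shows "num_cycles S p \<le> card S"
  unfolding num_cycles_def by (rule card_image_le[OF assms])

lemma num_cycles_id: "num_cycles S id = card S"
proof -
  have "orbit id x = {x}" for x :: 'a
    by (auto simp: orbit_altdef)
  then show ?thesis
    unfolding num_cycles_def by (simp add: card_image)
qed

definition orbits_avoiding :: "'a set \<Rightarrow> 'a \<Rightarrow> 'a \<Rightarrow> ('a \<Rightarrow> 'a) \<Rightarrow> 'a set set" where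
  "orbits_avoiding S a b p = {A \<in> orbit p ` S. a \<notin> A \<and> b \<notin> A}"

text \<open>Distinct orbits of a permutation are disjoint, so only those of \<open>a\<close> and
  \<open>b\<close> meet \<open>{a, b}\<close>. The last summand is 1 if the two points share a cycle
  and 2 otherwise; it isolates what swapping \<open>a\<close> and \<open>b\<close> can
  change.\<close>

lemma num_cycles_split:
  assumes "finite S" "p permutes S" "a \<in> S" "b \<in> S"
  shows "num_cycles S p = card (orbits_avoiding S a b p) + card {orbit p a, orbit p b}"
proof -
  have perm: "permutation p"
    using assms permutes_imp_permutation by blast
  \<comment> \<open>\<open>orbit\<close> collects positive iterates only, so a point returns to
    itself because \<open>p\<close> is a permutation with finite support.\<close>
  have self: "x \<in> orbit p x" for x
    by (rule permutation_self_in_orbit[OF perm])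
  have eq: "orbit p x = orbit p c" if "c \<in> orbit p x" for c x
    using that self by (meson orbit_swap orbit_trans subset_antisym subsetI)
  have "orbit p ` S = orbits_avoiding S a b p \<union> {orbit p a, orbit p b}"
    using assms(3,4) eq by (auto simp: orbits_avoiding_def)
  moreover have "orbits_avoiding S a b p \<inter> {orbit p a, orbit p b} = {}"
    using self by (auto simp: orbits_avoiding_def)
  moreover have "finite (orbits_avoiding S a b p)"
    using assms(1) by (simp add: orbits_avoiding_def)
  ultimately show ?thesis
    unfolding num_cycles_def by (metis card_Un_disjoint finite.emptyI finite.insertI)
qed

text \<open>Along an orbit that misses \<open>a\<close> and \<open>b\<close>, \<open>p\<close> never
  takes either value, so the transposition has nothing to move there.\<close>

lemma orbits_avoiding_transpose:
  assumes "finite S" "p permutes S" "a \<in> S" "b \<in> S"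
  shows "orbits_avoiding S a b (transpose a b \<circ> p) = orbits_avoiding S a b p"
proof -
  have sub: "orbits_avoiding S a b q \<subseteq> orbits_avoiding S a b (transpose a b \<circ> q)"
    if "q permutes S" for q
  proof
    fix A assume A: "A \<in> orbits_avoiding S a b q"
    then obtain x where x: "x \<in> S" "A = orbit q x" "a \<notin> A" "b \<notin> A"
      by (auto simp: orbits_avoiding_def)
    have self: "x \<in> orbit q x"
      using that assms(1) permutes_imp_permutation permutation_self_in_orbit by metis
    have "orbit (transpose a b \<circ> q) x = orbit q x"
    proof (rule orbit_cong[OF self])
      fix s assume "s \<in> orbit q x"
      then have "q s \<in> A" by (auto simp: x(2) intro: orbit.step)
      then have "q s \<noteq> a" "q s \<noteq> b" using x by auto
      then show "(transpose a b \<circ> q) s = q s" by simp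
    qed
    then show "A \<in> orbits_avoiding S a b (transpose a b \<circ> q)"
      using x by (auto simp: orbits_avoiding_def)
  qed
  have "transpose a b \<circ> p permutes S"
    using assms by (intro permutes_compose permutes_swap_id)
  \<comment> \<open>The transposition is an involution: \<open>sub\<close> applied to
    \<open>transpose a b \<circ> p\<close> leads back to \<open>p\<close> and gives the reverse
    inclusion.\<close>
  from sub[OF this] sub[OF assms(2)] show ?thesis
    by (simp add: comp_assoc[symmetric])
qed

text \<open>The orbits avoiding both points cancel, leaving the difference of two numbers in {1,
  2}.\<close>

lemma num_cycles_transpose_diff:
  assumes "finite S" "p permutes S" "a \<in> S" "b \<in> S"
  shows "\<bar>int (num_cycles S (transpose a b \<circ> p)) - int (num_cycles S p)\<bar> \<le> 1"
proof -
  have perm: "transpose a b \<circ> p permutes S"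
    using assms by (intro permutes_compose permutes_swap_id)
  have card: "1 \<le> card {A, B}" "card {A, B} \<le> 2" for A B :: "'a set"
    by (auto simp: card_insert_if)
  show ?thesis
    using card[of "orbit p a" "orbit p b"]
      card[of "orbit (transpose a b \<circ> p) a" "orbit (transpose a b \<circ> p) b"]
    unfolding num_cycles_split[OF assms] num_cycles_split[OF assms(1) perm assms(3,4)]
      orbits_avoiding_transpose[OF assms]
    by linarith
qed

text \<open>Under \<open>p\<close> the points \<open>a\<close> and \<open>p a\<close> share an
  orbit; after the transposition \<open>a\<close> is fixed, so they lie in two. The other orbits are
  unchanged.\<close>

lemma num_cycles_split_fixed_point:
  assumes "finite S" "p permutes S" "p a \<noteq> a"
  shows "num_cycles S (transpose a (p a) \<circ> p) = Suc (num_cycles S p)"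
proof -
  define q where "q = transpose a (p a) \<circ> p"
  have a: "a \<in> S" using assms permutes_not_in by metis
  have b: "p a \<in> S" using a assms permutes_in_image by metis
  have q: "q permutes S"
    unfolding q_def using assms a b by (intro permutes_compose permutes_swap_id)
  have qa: "q a = a" by (simp add: q_def)
  have "(q ^^ k) a = a" for k using qa by (induction k) auto
  then have "orbit q a = {a}" by (auto simp: orbit_altdef)
  moreover have "p a \<in> orbit q (p a)"
    using q assms(1) permutes_imp_permutation permutation_self_in_orbit by metis
  ultimately have "orbit q a \<noteq> orbit q (p a)" using assms(3) by auto
  moreover have "orbit p (p a) = orbit p a"
    using assms(1,2) permutes_imp_permutation permutation_orbit_step by metis
  ultimately show ?thesis
    using num_cycles_split[OF assms(1,2) a b] num_cycles_split[OF assms(1) q a b]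
      orbits_avoiding_transpose[OF assms(1,2) a b]
    by (simp add: q_def[symmetric])
qed

text \<open>Induction on the bound replaces an explicit factorization into transpositions: splitting
  off a moved point of \<open>\<alpha>\<close> lowers the bound by 1, and restoring the
  transposition changes the count for the product with \<open>\<gamma>\<close> by at most 1.\<close>

lemma num_cycles_comp_diff:
  assumes "finite S" "\<alpha> permutes S" "\<gamma> permutes S"
  shows "\<bar>int (num_cycles S (\<alpha> \<circ> \<gamma>)) - int (num_cycles S \<gamma>)\<bar> \<le> int (card S) - int (num_cycles S \<alpha>)"
  using assms(2)
proof (induction "card S - num_cycles S \<alpha>" arbitrary: \<alpha> rule: less_induct)
  case less
  show ?case
  proof (cases "\<alpha> = id")
    case True
    then show ?thesis by (simp add: num_cycles_id)
  next
    case False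
    then obtain a where moved: "\<alpha> a \<noteq> a" by (auto simp: fun_eq_iff)
    define \<beta> where "\<beta> = transpose a (\<alpha> a) \<circ> \<alpha>"
    have a: "a \<in> S" using moved less.prems permutes_not_in by metis
    have b: "\<alpha> a \<in> S" using a less.prems permutes_in_image by metis
    have \<beta>: "\<beta> permutes S"
      unfolding \<beta>_def using less.prems a b by (intro permutes_compose permutes_swap_id)
    have more: "num_cycles S \<beta> = Suc (num_cycles S \<alpha>)"
      unfolding \<beta>_def by (rule num_cycles_split_fixed_point[OF assms(1) less.prems moved])
    \<comment> \<open>Subtraction on naturals truncates; the decrease is strict because the larger
      count for \<open>\<beta>\<close> is still at most \<open>card S\<close>.\<close>
    with num_cycles_le_card[OF assms(1), of \<beta>]
    have "card S - num_cycles S \<beta> < card S - num_cycles S \<alpha>" by linarith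
    note IH = less.hyps[OF this \<beta>]
    \<comment> \<open>Applying the same transposition twice recovers \<open>\<alpha>\<close> from
      \<open>\<beta>\<close>.\<close>
    have "\<alpha> \<circ> \<gamma> = transpose a (\<alpha> a) \<circ> (\<beta> \<circ> \<gamma>)"
      by (simp add: \<beta>_def comp_assoc[symmetric])
    with num_cycles_transpose_diff[OF assms(1) permutes_compose[OF assms(3) \<beta>] a b]
    have "\<bar>int (num_cycles S (\<alpha> \<circ> \<gamma>)) - int (num_cycles S (\<beta> \<circ> \<gamma>))\<bar> \<le> 1" by simp
    with IH more show ?thesis by linarith
  qed
qed

theorem theorem6:
  fixes n :: nat and \<alpha> :: "nat \<Rightarrow> nat"
  assumes "n \<ge> 1"
    and "\<alpha> permutes {1..n}"
  shows "Max {\<bar>int (num_cycles {1..n} (\<alpha> \<circ> \<gamma>)) - int (num_cycles {1..n} \<gamma>)\<bar> | \<gamma>. \<gamma> permutes {1..n}}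
           = int n - int (num_cycles {1..n} \<alpha>)"
proof (rule Max_eqI)
  show "finite {\<bar>int (num_cycles {1..n} (\<alpha> \<circ> \<gamma>)) - int (num_cycles {1..n} \<gamma>)\<bar> | \<gamma>. \<gamma> permutes {1..n}}"
    by (simp add: setcompr_eq_image finite_permutations)
next
  fix y
  assume "y \<in> {\<bar>int (num_cycles {1..n} (\<alpha> \<circ> \<gamma>)) - int (num_cycles {1..n} \<gamma>)\<bar> | \<gamma>. \<gamma> permutes {1..n}}"
  then show "y \<le> int n - int (num_cycles {1..n} \<alpha>)"
    using num_cycles_comp_diff[OF finite_atLeastAtMost assms(2)] by auto
next
  \<comment> \<open>The identity has \<open>n\<close> cycles and \<open>\<alpha>\<close> at most
    \<open>n\<close>, so the absolute value reverses the sign.\<close>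
  have "int n - int (num_cycles {1..n} \<alpha>)
      = \<bar>int (num_cycles {1..n} (\<alpha> \<circ> id)) - int (num_cycles {1..n} id)\<bar>"
    using num_cycles_le_card[of "{1..n}" \<alpha>] by (simp add: num_cycles_id)
  then show "int n - int (num_cycles {1..n} \<alpha>)
      \<in> {\<bar>int (num_cycles {1..n} (\<alpha> \<circ> \<gamma>)) - int (num_cycles {1..n} \<gamma>)\<bar> | \<gamma>. \<gamma> permutes {1..n}}"
    using permutes_id by blast
qed

end
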